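(* Let $P$ be a finite-dimensional primitive (left) Leibniz algebra over a field $F$, with socle $C$. Then $P$ splits over $C$, i.e. there exists a subalgebra $U$ of $P$ with $U+C=P$ and $U\cap C=0$ (a complement to $C$ in $P$), and all complements to $C$ in $P$ are $C$-conjugate.
   Context: $F$ is an arbitrary field. A (left) Leibniz algebra is a vector space $A$ over $F$ with a bilinear product satisfying $a(bc)=(ab)c+b(ac)$ for all $a,b,c\in A$. Ideals are two-sided; a minimal ideal is a nonzero ideal minimal under inclusion among nonzero ideals. $A$ is soluble if $A^{(r)}=0$ for some $r$, where $A^{(0)}=A$ and $A^{(r+1)}=(A^{(r)})^2$ (the span of products of two elements of $A^{(r)}$). The centraliser of a subalgebra $U$ in $A$ is $\mathcal{C}_A(U)=\{x\in A\mid xU=Ux=0\}$. A soluble Leibniz algebra $A$ is primitive if it has a minimal ideal $C$ such that $\mathcal{C}_A(C)=C$. The socle of $A$ is the sum of the minimal ideals of $A$ (for a primitive algebra this is its unique minimal ideal, and it is abelian, i.e. has zero product). For an abelian ideal $C$ of $A$ and $c\in C$, let $L_c(x)=cx$; the map $\alpha_c=1+L_c\colon A\to A$ is an automorphism of $A$. Subalgebras $U,V$ of $A$ are $C$-conjugate if $V=\alpha_c(U)$ for some $c\in C$. *)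

theory Defs
  imports Complex_Main
begin

text \<open>
  The algebra lives on a whole type; the scalars range over an arbitrary field.
\<close>

locale leibniz_algebra = vector_space scale
  for scale :: "'f::field \<Rightarrow> 'a::ab_group_add \<Rightarrow> 'a" (infixr "*s" 75) +
  fixes mul :: "'a \<Rightarrow> 'a \<Rightarrow> 'a" (infixl "\<cdot>" 70)
  assumes linear_mul_left: "Vector_Spaces.linear scale scale (\<lambda>x. x \<cdot> y)"
    and linear_mul_right: "Vector_Spaces.linear scale scale (\<lambda>y. x \<cdot> y)"
    and left_leibniz: "a \<cdot> (b \<cdot> c) = (a \<cdot> b) \<cdot> c + b \<cdot> (a \<cdot> c)"
begin

definition finite_dimensional :: bool where
  "finite_dimensional \<longleftrightarrow> (\<exists>B. finite B \<and> span B = UNIV)"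

definition subalgebra :: "'a set \<Rightarrow> bool" where
  "subalgebra U \<longleftrightarrow> subspace U \<and> (\<forall>x\<in>U. \<forall>y\<in>U. x \<cdot> y \<in> U)"

definition ideal :: "'a set \<Rightarrow> bool" where
  "ideal I \<longleftrightarrow> subspace I \<and> (\<forall>a. \<forall>x\<in>I. a \<cdot> x \<in> I \<and> x \<cdot> a \<in> I)"

definition minimal_ideal :: "'a set \<Rightarrow> bool" where
  "minimal_ideal I \<longleftrightarrow> ideal I \<and> I \<noteq> {0} \<and> (\<forall>J. ideal J \<and> J \<noteq> {0} \<and> J \<subseteq> I \<longrightarrow> J = I)"

primrec derived :: "nat \<Rightarrow> 'a set" where
  "derived 0 = UNIV"
| "derived (Suc r) = span {x \<cdot> y | x y. x \<in> derived r \<and> y \<in> derived r}"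

definition soluble :: bool where
  "soluble \<longleftrightarrow> (\<exists>r. derived r = {0})"

definition centraliser :: "'a set \<Rightarrow> 'a set" where
  "centraliser U = {x. \<forall>u\<in>U. x \<cdot> u = 0 \<and> u \<cdot> x = 0}"

definition primitive :: bool where
  "primitive \<longleftrightarrow> soluble \<and> (\<exists>C. minimal_ideal C \<and> centraliser C = C)"

definition socle :: "'a set" where
  "socle = span (\<Union>{I. minimal_ideal I})"

definition complement :: "'a set \<Rightarrow> 'a set \<Rightarrow> bool" where
  "complement C U \<longleftrightarrow> subalgebra U \<and> {u + c | u c. u \<in> U \<and> c \<in> C} = UNIV \<and> U \<inter> C = {0}"

text \<open>
  The map \<open>1 + L\<^sub>c\<close>; it is an automorphism when \<open>c\<close> lies in an abelian ideal.
\<close>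

definition alpha :: "'a \<Rightarrow> 'a \<Rightarrow> 'a" where
  "alpha c x = x + c \<cdot> x"

text \<open>Meaningful for an abelian ideal \<open>C\<close> and subalgebras \<open>U\<close>, \<open>V\<close>.\<close>

definition conjugate :: "'a set \<Rightarrow> 'a set \<Rightarrow> 'a set \<Rightarrow> bool" where
  "conjugate C U V \<longleftrightarrow> (\<exists>c\<in>C. V = alpha c ` U)"

end

end

theory Submission
  imports Defs
begin

text \<open>
  Since \<open>C\<close> is minimal, either \<open>C\<cdot>P = 0\<close> or \<open>c\<cdot>a = -a\<cdot>c\<close> on \<open>C\<close>, so left multiplication controls
  everything. If \<open>P \<noteq> C\<close>, let \<open>D\<close> be the last term of the derived series not contained in \<open>C\<close>;
  then \<open>D\<cdot>D \<subseteq> C\<close> and the operators \<open>L\<^sub>d\<close> (\<open>d \<in> D\<close>) commute on \<open>C\<close>. The Fitting null component of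
  each \<open>L\<^sub>d\<close> on \<open>C\<close> is an ideal, hence \<open>0\<close> or \<open>C\<close>. If it were always \<open>C\<close>, the commuting nilpotent
  operators \<open>L\<^sub>d\<close> would have a common kernel, again an ideal, and \<open>D\<close> would centralise \<open>C\<close>. So some
  \<open>L\<^sub>d\<close> is bijective on \<open>C\<close>. As \<open>L\<^sub>d\<close> is a derivation with \<open>d\<cdot>(d\<cdot>P) \<subseteq> C\<close>, its Fitting null component
  \<open>{x. d\<cdot>(d\<cdot>x) = 0}\<close> on \<open>P\<close> is a complement. Conversely, every complement \<open>U\<close> has this form with \<open>d\<close>
  replaced by its component in \<open>U\<close>, and two such components differ by an element of \<open>C\<close>, which the
  surjectivity of \<open>L\<^sub>d\<close> on \<open>C\<close> turns into a conjugation.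
\<close>

section \<open>Endomorphisms of finite-dimensional spaces\<close>

context finite_dimensional_vector_space
begin

lemma linear_endo_inj_imp_surj:
  assumes f: "Vector_Spaces.linear scale scale f" and S: "subspace S" "f ` S \<subseteq> S"
    and inj: "\<And>x. x \<in> S \<Longrightarrow> f x = 0 \<Longrightarrow> x = 0"
  shows "f ` S = S"
proof -
  interpret vp: finite_dimensional_vector_space_pair_1 scale Basis scale
    by unfold_locales
  interpret f: Vector_Spaces.linear scale scale f
    by (rule f)
  have "inj_on f S"
  proof (rule inj_onI)
    fix x y assume "x \<in> S" "y \<in> S" "f x = f y"
    then show "x = y"
      using inj[of "x - y"] subspace_diff[OF S(1)] by (simp add: f.diff)
  qed
  then have "dim (f ` S) = dim S"
    using vp.dim_image_eq[OF f, of S] span_eq_iff[THEN iffD2, OF S(1)] by simp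
  then show ?thesis
    using subspace_dim_equal[OF f.subspace_image[OF S(1)] S] by simp
qed

text \<open>Induction on \<open>dim S\<close>: the kernel in \<open>S\<close> of an operator acting
  nontrivially is proper, nonzero by nilpotency, and invariant under the whole family by
  commutativity.\<close>

lemma commuting_nilpotents_common_kernel:
  assumes "subspace S" "S \<noteq> {0}"
    and lin: "\<And>d. d \<in> D \<Longrightarrow> Vector_Spaces.linear scale scale (f d)"
    and "\<And>d x. d \<in> D \<Longrightarrow> x \<in> S \<Longrightarrow> f d x \<in> S"
    and "\<And>d e x. d \<in> D \<Longrightarrow> e \<in> D \<Longrightarrow> x \<in> S \<Longrightarrow> f d (f e x) = f e (f d x)"
    and "\<And>d x. d \<in> D \<Longrightarrow> x \<in> S \<Longrightarrow> \<exists>n. (f d ^^ n) x = 0"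
  shows "\<exists>x\<in>S. x \<noteq> 0 \<and> (\<forall>d\<in>D. f d x = 0)"
  using assms(1,2,4-)
proof (induction "dim S" arbitrary: S rule: less_induct)
  case less
  obtain x where x: "x \<in> S" "x \<noteq> 0"
    using less.prems(1,2) subspace_0 by blast
  show ?case
  proof (cases "\<forall>d\<in>D. \<forall>y\<in>S. f d y = 0")
    case True
    then show ?thesis using x by blast
  next
    case False
    then obtain d y where d: "d \<in> D" and y: "y \<in> S" "f d y \<noteq> 0"
      by blast
    interpret fd: Vector_Spaces.linear scale scale "f d"
      by (rule lin[OF d])
    define K where "K = {z \<in> S. f d z = 0}"
    have K: "subspace K"
      using less.prems(1) by (auto simp: K_def subspace_def fd.add fd.scale)
    have "K \<subset> S"
      using y by (auto simp: K_def)
    then have dimK: "dim K < dim S"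
      using dim_psubset[of K S] span_eq_iff[THEN iffD2, OF K]
        span_eq_iff[THEN iffD2, OF less.prems(1)] by simp
    obtain n where n: "(f d ^^ n) x = 0"
      using less.prems(5) d x by blast
    \<comment> \<open>Since \<open>x\<close> is nonzero, the least annihilating power is a successor
      \<open>Suc k\<close>, and the \<open>k\<close>-th iterate of \<open>x\<close> is a nonzero
      vector of \<open>K\<close>.\<close>
    define m where "m = (LEAST n. (f d ^^ n) x = 0)"
    have m: "(f d ^^ m) x = 0"
      unfolding m_def by (rule LeastI[of _ n]) (rule n)
    then obtain k where k: "m = Suc k"
      using x by (cases m) auto
    have "(f d ^^ k) x \<noteq> 0"
      using not_less_Least[of k "\<lambda>n. (f d ^^ n) x = 0"] k unfolding m_def by auto
    moreover have "(f d ^^ j) x \<in> S" for j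
      by (induction j) (use x d less.prems(3) in auto)
    ultimately have "K \<noteq> {0}"
      using m k by (auto simp: K_def)
    have "\<exists>x\<in>K. x \<noteq> 0 \<and> (\<forall>d\<in>D. f d x = 0)"
    proof (rule less.hyps[OF dimK K \<open>K \<noteq> {0}\<close>])
      fix e z assume "e \<in> D" "z \<in> K"
      then show "f e z \<in> K"
        using less.prems(3)[of e z] less.prems(4)[of d e z] d lin[of e]
        by (auto simp: K_def Vector_Spaces.linear_iff_module_hom module_hom.zero fd.zero)
    qed (use less.prems(4,5) in \<open>auto simp: K_def\<close>)
    then show ?thesis
      by (auto simp: K_def)
  qed
qed

end

section \<open>Bilinearity, derived series and socle\<close>

context leibniz_algebra
begin

lemma mul_add_left: "(x + y) \<cdot> z = x \<cdot> z + y \<cdot> z"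
  and mul_scale_left: "(r *s x) \<cdot> z = r *s (x \<cdot> z)"
  and mul_zero_left [simp]: "0 \<cdot> z = 0"
  and mul_diff_left: "(x - y) \<cdot> z = x \<cdot> z - y \<cdot> z"
proof -
  interpret l: Vector_Spaces.linear scale scale "\<lambda>x. x \<cdot> z"
    by (rule linear_mul_left)
  show "(x + y) \<cdot> z = x \<cdot> z + y \<cdot> z" "(r *s x) \<cdot> z = r *s (x \<cdot> z)" "0 \<cdot> z = 0"
    "(x - y) \<cdot> z = x \<cdot> z - y \<cdot> z"
    by (rule l.add l.scale l.zero l.diff)+
qed

lemma mul_add_right: "z \<cdot> (x + y) = z \<cdot> x + z \<cdot> y"
  and mul_scale_right: "z \<cdot> (r *s x) = r *s (z \<cdot> x)"
  and mul_zero_right [simp]: "z \<cdot> 0 = 0"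
  and mul_diff_right: "z \<cdot> (x - y) = z \<cdot> x - z \<cdot> y"
proof -
  interpret l: Vector_Spaces.linear scale scale "\<lambda>x. z \<cdot> x"
    by (rule linear_mul_right)
  show "z \<cdot> (x + y) = z \<cdot> x + z \<cdot> y" "z \<cdot> (r *s x) = r *s (z \<cdot> x)" "z \<cdot> 0 = 0"
    "z \<cdot> (x - y) = z \<cdot> x - z \<cdot> y"
    by (rule l.add l.scale l.zero l.diff)+
qed

lemma funpow_mul_add: "((\<lambda>x. a \<cdot> x) ^^ n) (x + y) = ((\<lambda>x. a \<cdot> x) ^^ n) x + ((\<lambda>x. a \<cdot> x) ^^ n) y"
  by (induction n) (simp_all add: mul_add_right)

lemma funpow_mul_scale: "((\<lambda>x. a \<cdot> x) ^^ n) (r *s x) = r *s ((\<lambda>x. a \<cdot> x) ^^ n) x"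
  by (induction n) (simp_all add: mul_scale_right)

lemma funpow_mul_zero: "((\<lambda>x. a \<cdot> x) ^^ n) 0 = 0"
  by (induction n) simp_all

lemma square_mul: "(a \<cdot> a) \<cdot> b = 0"
  using left_leibniz[of a a b] by simp

text \<open>Left multiplication is a derivation, and the Leibniz identity read backwards turns right
  multiplication of a product into a difference of products of elements of \<open>I\<close>.\<close>

lemma ideal_span_products:
  assumes "ideal I"
  shows "ideal (span {x \<cdot> y | x y. x \<in> I \<and> y \<in> I})"
    (is "ideal (span ?P)")
proof -
  have "a \<cdot> z \<in> span ?P \<and> z \<cdot> a \<in> span ?P" if "z \<in> span ?P" for a z
    using that
  proof (induction rule: span_induct_alt)
    case base
    show ?case by (simp add: span_zero)
  next
    case (step r z w)
    then obtain x y where z: "z = x \<cdot> y" and xy: "x \<in> I" "y \<in> I" by blast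
    have I: "a \<cdot> x \<in> I" "a \<cdot> y \<in> I" "x \<cdot> a \<in> I" "y \<cdot> a \<in> I"
      using assms xy by (auto simp: ideal_def)
    have "a \<cdot> z = (a \<cdot> x) \<cdot> y + x \<cdot> (a \<cdot> y)" "z \<cdot> a = x \<cdot> (y \<cdot> a) - y \<cdot> (x \<cdot> a)"
      using z left_leibniz[of a x y] left_leibniz[of x y a] by simp_all
    moreover have "(a \<cdot> x) \<cdot> y + x \<cdot> (a \<cdot> y) \<in> span ?P"
      by (intro span_add span_base) (use xy I in blast)+
    moreover have "x \<cdot> (y \<cdot> a) - y \<cdot> (x \<cdot> a) \<in> span ?P"
      by (intro span_diff span_base) (use xy I in blast)+
    ultimately show ?case
      using step.IH
      by (simp add: mul_add_left mul_add_right mul_scale_left mul_scale_right span_add span_scale)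
  qed
  then show ?thesis
    by (auto simp: ideal_def)
qed

lemma ideal_derived: "ideal (derived r)"
  by (induction r) (use ideal_span_products in \<open>auto simp: ideal_def\<close>)

text \<open>Ideals meeting in zero annihilate each other, so a minimal ideal meeting
  \<open>C\<close> trivially would lie in the centraliser of \<open>C\<close>, which is
  \<open>C\<close> itself.\<close>

lemma socle_eq:
  assumes "minimal_ideal C" "centraliser C = C"
  shows "socle = C"
proof -
  have "I = C" if I: "minimal_ideal I" for I
  proof -
    have J: "ideal (I \<inter> C)"
      using I assms(1) by (auto simp: minimal_ideal_def ideal_def intro: subspace_inter)
    have "I \<inter> C \<noteq> {0}"
    proof
      assume 0: "I \<inter> C = {0}"
      have "x \<cdot> c \<in> I \<inter> C \<and> c \<cdot> x \<in> I \<inter> C" if "x \<in> I" "c \<in> C" for x c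
        using that I assms(1) by (auto simp: minimal_ideal_def ideal_def)
      then have "I \<subseteq> centraliser C"
        unfolding 0 centraliser_def by blast
      then show False
        using 0 assms(2) I by (auto simp: minimal_ideal_def)
    qed
    then have "I \<inter> C = I" "I \<inter> C = C"
      using J I assms(1) by (auto simp: minimal_ideal_def)
    then show ?thesis by blast
  qed
  then have "{I. minimal_ideal I} = {C}"
    using assms(1) by blast
  moreover have "span C = C"
    using assms(1) by (simp add: minimal_ideal_def ideal_def span_eq_iff)
  ultimately show ?thesis
    by (simp add: socle_def)
qed

end

section \<open>The action on a self-centralising minimal ideal\<close>

locale self_centralising_minimal_ideal = leibniz_algebra +
  fixes C
  assumes minimal: "minimal_ideal C" and self_centralising: "centraliser C = C"
begin

lemma subspace_C: "subspace C"
  and C_mul_left: "c \<in> C \<Longrightarrow> a \<cdot> c \<in> C"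
  and C_mul_right: "c \<in> C \<Longrightarrow> c \<cdot> a \<in> C"
  and C_nonzero: "C \<noteq> {0}"
  using minimal by (auto simp: minimal_ideal_def ideal_def)

lemma C_abelian: "c \<in> C \<Longrightarrow> e \<in> C \<Longrightarrow> c \<cdot> e = 0"
  using self_centralising by (auto simp: centraliser_def)

text \<open>The elements of \<open>C\<close> with zero left multiplication form an ideal, so they
  are all of \<open>C\<close> or only zero. Polarising \<open>square_mul\<close> shows that
  \<open>c \<cdot> a + a \<cdot> c\<close> is one of them.\<close>

lemma trivial_or_skew:
  "(\<forall>c\<in>C. \<forall>a. c \<cdot> a = 0) \<or> (\<forall>c\<in>C. \<forall>a. c \<cdot> a = - (a \<cdot> c))"
proof -
  define K where "K = {c \<in> C. \<forall>a. c \<cdot> a = 0}"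
  have "(a \<cdot> c) \<cdot> b = 0" if "c \<in> K" for a b c
    using left_leibniz[of a c b] that by (simp add: K_def)
  then have "ideal K"
    using subspace_C C_mul_left
    by (auto simp: ideal_def K_def subspace_def mul_add_left mul_scale_left)
  then consider "K = C" | "K = {0}"
    using minimal by (auto simp: minimal_ideal_def K_def)
  then show ?thesis
  proof cases
    case 1
    then show ?thesis by (auto simp: K_def)
  next
    case 2
    have "c \<cdot> a + a \<cdot> c \<in> K" if c: "c \<in> C" for a c
    proof -
      have "(c \<cdot> a + a \<cdot> c) \<cdot> b = 0" for b
        using square_mul[of "c + a" b] square_mul[of c b] square_mul[of a b]
        by (simp add: mul_add_left mul_add_right add.commute)
      then show ?thesis
        using c C_mul_left C_mul_right subspace_C by (auto simp: K_def intro: subspace_add)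
    qed
    then show ?thesis
      unfolding 2 by (auto simp: eq_neg_iff_add_eq_0)
  qed
qed

text \<open>By the dichotomy, right multiplication on \<open>W\<close> is zero or minus left
  multiplication, so left invariance already makes \<open>W\<close> an ideal.\<close>

lemma C_irreducible:
  assumes "subspace W" "W \<subseteq> C" "W \<noteq> {0}" "\<And>a w. w \<in> W \<Longrightarrow> a \<cdot> w \<in> W"
  shows "W = C"
proof -
  have "w \<cdot> a \<in> W" if "w \<in> W" for w a
  proof -
    from that assms(2) consider "w \<cdot> a = 0" | "w \<cdot> a = - (a \<cdot> w)"
      using trivial_or_skew by blast
    then show ?thesis
      using assms(1) assms(4)[OF that] by cases (auto intro: subspace_0 subspace_neg)
  qed
  then have "ideal W"
    using assms by (simp add: ideal_def)
  then show ?thesis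
    using minimal assms by (simp add: minimal_ideal_def)
qed

lemma left_centraliser_C: "(\<And>c. c \<in> C \<Longrightarrow> x \<cdot> c = 0) \<Longrightarrow> x \<in> C"
  using trivial_or_skew self_centralising by (fastforce simp: centraliser_def)

lemma exists_ideal_square_in_C:
  assumes "soluble" "C \<noteq> UNIV"
  obtains D where "ideal D" "\<not> D \<subseteq> C" "\<And>x y. x \<in> D \<Longrightarrow> y \<in> D \<Longrightarrow> x \<cdot> y \<in> C"
proof -
  obtain r where "derived r = {0}"
    using assms(1) by (auto simp: soluble_def)
  then have "derived r \<subseteq> C"
    using subspace_C by (simp add: subspace_0)
  moreover have "\<not> derived 0 \<subseteq> C"
    using assms(2) by auto
  \<comment> \<open>The term of index 0 is not inside \<open>C\<close>, so the least index of a term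
    inside \<open>C\<close> is a successor.\<close>
  ultimately obtain k where k: "\<not> derived k \<subseteq> C" "derived (Suc k) \<subseteq> C"
    using ex_least_nat_less[of "\<lambda>k. derived k \<subseteq> C" r] by blast
  have "x \<cdot> y \<in> C" if "x \<in> derived k" "y \<in> derived k" for x y
  proof -
    have "x \<cdot> y \<in> derived (Suc k)"
      using that by (auto intro!: span_base)
    then show ?thesis
      using k(2) by blast
  qed
  then show ?thesis
    using that[OF ideal_derived k(1)] by blast
qed

lemma exists_bijective_on_C:
  assumes fin: "finite_dimensional"
    and D: "ideal D" "\<not> D \<subseteq> C" "\<And>x y. x \<in> D \<Longrightarrow> y \<in> D \<Longrightarrow> x \<cdot> y \<in> C"
  obtains d where "d \<in> D" "\<And>c. c \<in> C \<Longrightarrow> d \<cdot> c = 0 \<Longrightarrow> c = 0" "(\<lambda>x. d \<cdot> x) ` C = C"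
proof -
  obtain B0 where B0: "finite B0" "span B0 = UNIV"
    using fin by (auto simp: finite_dimensional_def)
  \<comment> \<open>The spanning set is thinned to a basis because the finite-dimensional locale is
    parametrised by one.\<close>
  obtain B where B: "B \<subseteq> B0" "independent B" "B0 \<subseteq> span B"
    using maximal_independent_subset[of B0] by blast
  have "span B = UNIV"
    using B(3) B0(2) span_mono[of B0 "span B"] by (auto simp: span_span)
  interpret finite_dimensional_vector_space scale B
    by unfold_locales (use B B0 \<open>span B = UNIV\<close> finite_subset in auto)
  have D_mul: "a \<cdot> x \<in> D" "x \<cdot> a \<in> D" if "x \<in> D" for a x
    using D(1) that by (auto simp: ideal_def)
  \<comment> \<open>The Leibniz defect \<open>(x \<cdot> y) \<cdot> c\<close> is a product of two
    elements of \<open>C\<close>, hence zero.\<close>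
  have comm: "x \<cdot> (y \<cdot> c) = y \<cdot> (x \<cdot> c)" if "x \<in> D" "y \<in> D" "c \<in> C" for x y c
    using left_leibniz[of x y c] C_abelian[OF D(3) that(3)] that by simp
  define N where "N d = {c \<in> C. \<exists>n. ((\<lambda>x. d \<cdot> x) ^^ n) c = 0}" for d
  have N: "N d = {0} \<or> N d = C" if d: "d \<in> D" for d
  proof -
    let ?L = "\<lambda>x. d \<cdot> x"
    have funpow_comm: "(?L ^^ n) (x \<cdot> c) = x \<cdot> (?L ^^ n) c" if "x \<in> D" "c \<in> C" for n x c
    proof (induction n)
      case (Suc n)
      have "(?L ^^ n) c \<in> C"
        by (induction n) (use that C_mul_left in auto)
      then show ?case
        using Suc that comm d by simp
    qed simp
    \<comment> \<open>One extra power suffices for an arbitrary \<open>x\<close>: in \<open>d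
      \<cdot> (x \<cdot> c) = (d \<cdot> x) \<cdot> c + x \<cdot> (d \<cdot> c)\<close> the factor
      \<open>d \<cdot> x\<close> lies in \<open>D\<close> and commutes with the powers of
      \<open>?L\<close> on \<open>C\<close>, while \<open>d \<cdot> c\<close> needs one power
      less.\<close>
    have *: "(?L ^^ Suc n) (x \<cdot> c) = 0" if "(?L ^^ n) c = 0" "c \<in> C" for n x c
      using that
    proof (induction n arbitrary: c)
      case (Suc n)
      have "(?L ^^ n) (d \<cdot> c) = 0"
        using Suc.prems(1) by (simp add: funpow_swap1)
      then have "(?L ^^ Suc n) (x \<cdot> (d \<cdot> c)) = 0"
        using Suc C_mul_left by blast
      moreover have "(?L ^^ Suc n) ((d \<cdot> x) \<cdot> c) = 0"
        using funpow_comm[OF D_mul(2)[OF d] Suc.prems(2), where n = "Suc n"] Suc.prems(1)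
        by (metis mul_zero_right)
      moreover have "(?L ^^ Suc (Suc n)) (x \<cdot> c) = (?L ^^ Suc n) (d \<cdot> (x \<cdot> c))"
        by (simp only: funpow_Suc_right comp_def)
      ultimately show ?case
        by (simp only: left_leibniz[of d x c] funpow_mul_add add_0)
    qed simp
    have more: "(?L ^^ (m + n)) c = 0" if "(?L ^^ n) c = 0" for m n c
      using that by (simp add: funpow_add funpow_mul_zero)
    have "subspace (N d)"
      unfolding subspace_def
    proof (intro conjI ballI allI)
      show "0 \<in> N d"
        using subspace_C by (auto simp: N_def subspace_0 intro: exI[of _ 0])
    next
      fix x y assume "x \<in> N d" "y \<in> N d"
      then obtain m n where xy: "x \<in> C" "y \<in> C" "(?L ^^ m) x = 0" "(?L ^^ n) y = 0"
        by (auto simp: N_def)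
      have "(?L ^^ (m + n)) (x + y) = 0"
        using more[OF xy(3), of n] more[OF xy(4), of m] by (simp add: funpow_mul_add add.commute)
      then show "x + y \<in> N d"
        using xy subspace_C by (auto simp: N_def subspace_add)
    next
      fix r x assume "x \<in> N d"
      then show "r *s x \<in> N d"
        using subspace_C by (auto simp: N_def subspace_scale funpow_mul_scale intro!: exI)
    qed
    moreover have "a \<cdot> w \<in> N d" if "w \<in> N d" for a w
      using that * C_mul_left unfolding N_def by blast
    ultimately show ?thesis
      using C_irreducible[of "N d"] by (auto simp: N_def)
  qed
  have "\<exists>d\<in>D. N d = {0}"
  proof (rule ccontr)
    assume "\<not> ?thesis"
    then have nil: "N d = C" if "d \<in> D" for d
      using N that by blast
    define Z where "Z = {c \<in> C. \<forall>d\<in>D. d \<cdot> c = 0}"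
    have "\<exists>x\<in>C. x \<noteq> 0 \<and> (\<forall>d\<in>D. d \<cdot> x = 0)"
    proof (rule commuting_nilpotents_common_kernel[where f = "\<lambda>d x. d \<cdot> x"])
      fix d x assume "d \<in> D" "x \<in> C"
      then show "\<exists>n. ((\<lambda>x. d \<cdot> x) ^^ n) x = 0"
        using nil[of d] by (auto simp: N_def)
    qed (use subspace_C C_nonzero linear_mul_right C_mul_left comm in auto)
    then have "Z \<noteq> {0}"
      by (auto simp: Z_def)
    moreover have "subspace Z"
      using subspace_C by (auto simp: Z_def subspace_def mul_add_right mul_scale_right)
    \<comment> \<open>In \<open>d \<cdot> (a \<cdot> z) = (d \<cdot> a) \<cdot> z + a \<cdot> (d
      \<cdot> z)\<close> both terms vanish, as \<open>d \<cdot> a\<close> is again in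
      \<open>D\<close>.\<close>
    moreover have "a \<cdot> z \<in> Z" if "z \<in> Z" for a z
      using that left_leibniz[of _ a z] D_mul C_mul_left by (auto simp: Z_def)
    ultimately have "Z = C"
      using C_irreducible[of Z] by (auto simp: Z_def)
    then show False
      using D(2) left_centraliser_C by (auto simp: Z_def)
  qed
  then obtain d where d: "d \<in> D" "N d = {0}"
    by blast
  have inj: "c = 0" if "c \<in> C" "d \<cdot> c = 0" for c
  proof -
    have "c \<in> N d"
      using that by (auto simp: N_def intro!: exI[of _ 1])
    then show ?thesis
      using d by simp
  qed
  then have "(\<lambda>x. d \<cdot> x) ` C = C"
    by (intro linear_endo_inj_imp_surj linear_mul_right subspace_C) (use C_mul_left in auto)
  then show ?thesis
    using that d inj by blast
qed

section \<open>Complements as null components, and their conjugacy\<close>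

lemma complement_null_component:
  assumes inj: "\<And>c. c \<in> C \<Longrightarrow> d \<cdot> c = 0 \<Longrightarrow> c = 0" and surj: "(\<lambda>x. d \<cdot> x) ` C = C"
    and sq: "\<And>x. d \<cdot> (d \<cdot> x) \<in> C" "\<And>x y. (d \<cdot> x) \<cdot> (d \<cdot> y) \<in> C"
  shows "complement C {x. d \<cdot> (d \<cdot> x) = 0}"
  unfolding complement_def
proof (intro conjI)
  \<comment> \<open>The second power already gives the full Fitting null component, since
    \<open>d \<cdot> (d \<cdot> x)\<close> lies in \<open>C\<close>, where left multiplication by
    \<open>d\<close> is injective.\<close>
  let ?U = "{x. d \<cdot> (d \<cdot> x) = 0}"
  have "x \<cdot> y \<in> ?U" if "x \<in> ?U" "y \<in> ?U" for x y
  proof -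
    let ?p = "(d \<cdot> x) \<cdot> (d \<cdot> y) + (d \<cdot> x) \<cdot> (d \<cdot> y)"
    \<comment> \<open>Second-order product rule: the outer terms vanish and the mixed term occurs
      twice. It lies in \<open>C\<close> and is killed by \<open>d\<close>, hence is zero in any
      characteristic.\<close>
    have eq: "d \<cdot> (d \<cdot> (x \<cdot> y)) = ?p"
      using that
      by (simp add: left_leibniz[of d x y] left_leibniz[of d "d \<cdot> x" y]
          left_leibniz[of d x "d \<cdot> y"] mul_add_right)
    have "d \<cdot> ?p = 0"
      using that by (simp add: left_leibniz[of d "d \<cdot> x" "d \<cdot> y"] mul_add_right)
    moreover have "?p \<in> C"
      using sq(2) subspace_C subspace_add by blast
    ultimately show ?thesis
      using inj eq by simp
  qed
  then show "subalgebra ?U"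
    by (auto simp: subalgebra_def subspace_def mul_add_right mul_scale_right)
  show "{u + c | u c. u \<in> ?U \<and> c \<in> C} = UNIV"
  proof (intro equalityI subsetI UNIV_I)
    fix x
    \<comment> \<open>Surjectivity on \<open>C\<close> is used twice, to solve
      \<open>d \<cdot> (d \<cdot> c) = d \<cdot> (d \<cdot> x)\<close> with \<open>c\<close> in
      \<open>C\<close>.\<close>
    obtain c' where "c' \<in> C" "d \<cdot> (d \<cdot> x) = d \<cdot> c'"
      using sq(1)[of x] surj by (metis imageE)
    moreover obtain c where "c \<in> C" "c' = d \<cdot> c"
      using \<open>c' \<in> C\<close> surj by (metis imageE)
    ultimately have "x - c \<in> ?U" "x = (x - c) + c"
      by (simp_all add: mul_diff_right)
    with \<open>c \<in> C\<close> show "x \<in> {u + c | u c. u \<in> ?U \<and> c \<in> C}"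
      by blast
  qed
  show "?U \<inter> C = {0}"
    using inj subspace_C C_mul_left by (auto simp: subspace_0)
qed

text \<open>For \<open>x\<close> in \<open>U\<close> the element
  \<open>u \<cdot> (u \<cdot> x)\<close> lies in both \<open>U\<close> and \<open>C\<close>.
  Conversely, the \<open>C\<close>-component of a null vector is killed by two injective
  steps.\<close>

lemma complement_eq_null_component:
  assumes U: "complement C U" and u: "u \<in> U"
    and inj: "\<And>c. c \<in> C \<Longrightarrow> u \<cdot> c = 0 \<Longrightarrow> c = 0" and sq: "\<And>x. u \<cdot> (u \<cdot> x) \<in> C"
  shows "U = {x. u \<cdot> (u \<cdot> x) = 0}"
proof
  have U': "subspace U" "\<And>x y. x \<in> U \<Longrightarrow> y \<in> U \<Longrightarrow> x \<cdot> y \<in> U" "U \<inter> C = {0}"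
    using U by (auto simp: complement_def subalgebra_def)
  show le: "U \<subseteq> {x. u \<cdot> (u \<cdot> x) = 0}"
    using U' u sq by blast
  show "{x. u \<cdot> (u \<cdot> x) = 0} \<subseteq> U"
  proof
    fix x assume x: "x \<in> {x. u \<cdot> (u \<cdot> x) = 0}"
    have "x \<in> {u + c | u c. u \<in> U \<and> c \<in> C}"
      using U by (simp add: complement_def)
    then obtain w c where wc: "x = w + c" "w \<in> U" "c \<in> C"
      by blast
    then have "u \<cdot> (u \<cdot> c) = 0"
      using x le by (auto simp: mul_add_right)
    then have "c = 0"
      using inj wc C_mul_left by blast
    then show "x \<in> U"
      using wc by simp
  qed
qed

text \<open>The only term beyond the Leibniz identity,
  \<open>(c \<cdot> x) \<cdot> (c \<cdot> y)\<close>, is a product inside the abelian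
  \<open>C\<close>.\<close>

lemma alpha_mul:
  assumes "c \<in> C"
  shows "alpha c (x \<cdot> y) = alpha c x \<cdot> alpha c y"
  using left_leibniz[of c x y] C_abelian[of "c \<cdot> x" "c \<cdot> y"] C_mul_right[OF assms]
  by (simp add: alpha_def mul_add_left mul_add_right)

text \<open>\<open>alpha c\<close> moves points only by elements of \<open>C\<close>, so
  \<open>y\<close> and the image of its \<open>U\<close>-component differ by an element of both
  \<open>V\<close> and \<open>C\<close>.\<close>

lemma alpha_image_complement:
  assumes U: "complement C U" and V: "complement C V" and c: "c \<in> C" and sub: "alpha c ` U \<subseteq> V"
  shows "V = alpha c ` U"
proof (intro equalityI sub subsetI)
  fix y assume y: "y \<in> V"
  have "y \<in> {u + c | u c. u \<in> U \<and> c \<in> C}"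
    using U by (simp add: complement_def)
  then obtain w e where we: "y = w + e" "w \<in> U" "e \<in> C"
    by blast
  have eq: "y - alpha c w = e - c \<cdot> w"
    using we by (simp add: alpha_def)
  have "y - alpha c w \<in> V"
    using y we sub V by (auto simp: complement_def subalgebra_def intro!: subspace_diff)
  moreover have "y - alpha c w \<in> C"
    unfolding eq using we C_mul_right[OF c] subspace_C by (intro subspace_diff)
  ultimately have "y - alpha c w \<in> V \<inter> C"
    by (rule IntI)
  then have "y - alpha c w = 0"
    using V by (simp only: complement_def singleton_iff)
  then show "y \<in> alpha c ` U"
    using we by simp
qed

lemma complements_conjugate:
  assumes inj: "\<And>c. c \<in> C \<Longrightarrow> d \<cdot> c = 0 \<Longrightarrow> c = 0" and surj: "(\<lambda>x. d \<cdot> x) ` C = C"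
    and sq: "\<And>x. d \<cdot> (d \<cdot> x) \<in> C"
    and U: "complement C U" and V: "complement C V"
  shows "conjugate C U V"
proof -
  have component: "\<exists>w\<in>W. \<exists>c\<in>C. d = w + c \<and> (\<forall>e\<in>C. w \<cdot> e = d \<cdot> e) \<and> W = {x. w \<cdot> (w \<cdot> x) = 0}"
    if W: "complement C W" for W
  proof -
    have "d \<in> {w + c | w c. w \<in> W \<and> c \<in> C}"
      using W by (simp add: complement_def)
    then obtain w c where wc: "d = w + c" "w \<in> W" "c \<in> C"
      by blast
    \<comment> \<open>Changing \<open>d\<close> by an element of the abelian \<open>C\<close> leaves
      its left action on \<open>C\<close> unchanged.\<close>
    have act: "w \<cdot> e = d \<cdot> e" if "e \<in> C" for e
      using wc that C_abelian by (simp add: mul_add_left)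
    have "w \<cdot> (w \<cdot> x) \<in> C" for x
    proof -
      have w: "w = d - c"
        using wc by simp
      have "w \<cdot> (w \<cdot> x) = d \<cdot> (d \<cdot> x) - d \<cdot> (c \<cdot> x) - c \<cdot> (w \<cdot> x)"
        unfolding w by (simp add: mul_diff_left mul_diff_right)
      then show ?thesis
        using sq C_mul_left C_mul_right wc(3) subspace_C by (auto intro!: subspace_diff)
    qed
    then have "W = {x. w \<cdot> (w \<cdot> x) = 0}"
      using complement_eq_null_component[OF W wc(2)] act inj by simp
    then show ?thesis
      using wc act by blast
  qed
  obtain u c0 where u: "u \<in> U" "c0 \<in> C" "d = u + c0" "\<forall>e\<in>C. u \<cdot> e = d \<cdot> e"
    and U_eq: "U = {x. u \<cdot> (u \<cdot> x) = 0}"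
    using component[OF U] by blast
  obtain v c1 where v: "v \<in> V" "c1 \<in> C" "d = v + c1"
    and V_eq: "V = {x. v \<cdot> (v \<cdot> x) = 0}"
    using component[OF V] by blast
  define c' where "c' = c0 - c1"
  have c': "c' \<in> C" "v = u + c'"
    using u v subspace_C by (auto simp: c'_def subspace_diff algebra_simps)
  \<comment> \<open>If \<open>C\<close> has zero left multiplication, \<open>u\<close> and
    \<open>v\<close> act alike from the left and have equal null components, so \<open>c = 0\<close>
    serves even though \<open>alpha c u\<close> need not equal \<open>v\<close>.\<close>
  have "\<exists>c\<in>C. alpha c u = v \<or> (\<forall>a. c' \<cdot> a = 0) \<and> c = 0"
    using trivial_or_skew
  proof
    assume "\<forall>c\<in>C. \<forall>a. c \<cdot> a = 0"
    then show ?thesis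
      using c' subspace_C subspace_0 by blast
  next
    assume skew: "\<forall>c\<in>C. \<forall>a. c \<cdot> a = - (a \<cdot> c)"
    have "- c' \<in> (\<lambda>x. d \<cdot> x) ` C"
      unfolding surj using c' subspace_C by (simp add: subspace_neg)
    then obtain c where c: "c \<in> C" "d \<cdot> c = - c'"
      by (metis imageE)
    \<comment> \<open>Skewness gives
      \<open>c \<cdot> u = - (u \<cdot> c) = - (d \<cdot> c) = c'\<close>.\<close>
    then have "alpha c u = v"
      using skew u(4) c' by (simp add: alpha_def)
    then show ?thesis
      using c by blast
  qed
  then obtain c where c: "c \<in> C" "alpha c u = v \<or> (\<forall>a. c' \<cdot> a = 0) \<and> c = 0"
    by blast
  have "alpha c x \<in> V" if "x \<in> U" for x
    using c(2)
  proof
    assume "alpha c u = v"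
    then have "v \<cdot> (v \<cdot> alpha c x) = alpha c (u \<cdot> (u \<cdot> x))"
      using alpha_mul c(1) by simp
    also have "\<dots> = 0"
      using that U_eq by (simp add: alpha_def)
    finally show ?thesis
      by (simp add: V_eq)
  next
    assume "(\<forall>a. c' \<cdot> a = 0) \<and> c = 0"
    then show ?thesis
      using that U_eq c'(2) by (simp add: V_eq alpha_def mul_add_left)
  qed
  then show ?thesis
    using alpha_image_complement[OF U V c(1)] c(1) unfolding conjugate_def by blast
qed

lemma splits_and_conjugate:
  assumes "finite_dimensional" "soluble"
  shows "(\<exists>U. complement C U) \<and> (\<forall>U V. complement C U \<and> complement C V \<longrightarrow> conjugate C U V)"
proof (cases "C = UNIV")
  case True
  \<comment> \<open>When \<open>C\<close> is everything, zero is the only complement and every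
    \<open>alpha c\<close> fixes it.\<close>
  have "complement C {0}"
    using True subspace_single_0 by (auto simp: complement_def subalgebra_def)
  moreover have "conjugate C U V" if "complement C U" "complement C V" for U V
    using that True by (auto simp: complement_def conjugate_def alpha_def)
  ultimately show ?thesis
    by blast
next
  case False
  obtain D where D: "ideal D" "\<not> D \<subseteq> C" "\<And>x y. x \<in> D \<Longrightarrow> y \<in> D \<Longrightarrow> x \<cdot> y \<in> C"
    using exists_ideal_square_in_C[OF assms(2) False] by blast
  obtain d where d: "d \<in> D" "\<And>c. c \<in> C \<Longrightarrow> d \<cdot> c = 0 \<Longrightarrow> c = 0" "(\<lambda>x. d \<cdot> x) ` C = C"
    using exists_bijective_on_C[OF assms(1) D] by blast
  have "d \<cdot> x \<in> D" for x
    using D(1) d(1) by (simp add: ideal_def)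
  then have sq: "d \<cdot> (d \<cdot> x) \<in> C" "(d \<cdot> x) \<cdot> (d \<cdot> y) \<in> C" for x y
    using D(3) d(1) by blast+
  show ?thesis
    using complement_null_component[OF d(2,3) sq] complements_conjugate[OF d(2,3) sq(1)] by blast
qed

end

theorem theorem3p14:
  fixes scale :: "'f::field \<Rightarrow> 'a::ab_group_add \<Rightarrow> 'a"
    and mul :: "'a \<Rightarrow> 'a \<Rightarrow> 'a"
    and C :: "'a set"
  assumes "leibniz_algebra scale mul"
    and "leibniz_algebra.finite_dimensional scale"
    and "leibniz_algebra.primitive scale mul"
    and "C = leibniz_algebra.socle scale mul"
  shows "(\<exists>U. leibniz_algebra.complement scale mul C U) \<and>
    (\<forall>U V. leibniz_algebra.complement scale mul C U \<and> leibniz_algebra.complement scale mul C V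
       \<longrightarrow> leibniz_algebra.conjugate mul C U V)"
proof -
  interpret leibniz_algebra scale mul
    by (rule assms(1))
  obtain C0 where C0: "minimal_ideal C0" "centraliser C0 = C0" and sol: "soluble"
    using assms(3) by (auto simp: primitive_def)
  have "C = C0"
    using assms(4) socle_eq[OF C0] by simp
  with C0 interpret self_centralising_minimal_ideal scale mul C
    by unfold_locales simp_all
  show ?thesis
    using splits_and_conjugate[OF assms(2) sol] .
qed

end
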